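(* Consider a single DRCCP ($I=1$) under the type $\infty$-Wasserstein ambiguity set with affine mappings $a_1(x)=x$, $b_1(x)=b_1$ (a constant), where the reference distribution is elliptical, $\tilde\zeta\sim\mathbb{P}_{\mathrm E}(\mu,\Sigma,\hat g)$. Suppose that $\mathcal X\subseteq\{0,1\}^n$, $\mu\ge0$ (componentwise), $\Sigma=\mathrm{Diag}(\mu)$, and $\Phi^{-1}(1-\varepsilon)+\theta\ge0$. Then ALSO-X# is exact, i.e., $v^{A\#}=v^*$.
   Context: $c\in\mathbb{R}^n$, $b_1\in\mathbb{R}$, $\varepsilon\in(0,1)$, $\theta\ge0$, $(y)_+=\max\{y,0\}$; $\mathrm{Diag}(\mu)$ is the diagonal matrix with diagonal $\mu$. The norm defining the Wasserstein distance is the generalized Mahalanobis norm $\|y\|=\sqrt{y^\top\Sigma^\dagger y}$ ($\Sigma^\dagger$ the pseudo-inverse), whose dual norm is taken to be $\|x\|_*=\sqrt{x^\top\Sigma x}$. Elliptical distribution $\mathbb{P}_{\mathrm E}(\mu,\Sigma,\hat g)$: location $\mu\in\mathbb{R}^n$, positive semidefinite $\Sigma$, generating function $\hat g$, with density $\bar k\,\hat g(\frac12(x-\mu)^\top\Sigma^{-1}(x-\mu))$, $\bar k>0$ a normalization constant. The standard univariate elliptical distribution $\mathbb{P}_{\mathrm E}(0,1,\hat g)$ has density $\varphi(z)=\bar k\hat g(z^2/2)$ and cumulative distribution function $\Phi(\tau)=\int_{-\infty}^\tau\bar k\hat g(z^2/2)\,dz$. In general (also for singular $\Sigma$), for every $x\in\mathbb{R}^n$,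 $x^\top\tilde\zeta$ has the law of $\mu^\top x+\sqrt{x^\top\Sigma x}\,Z$ with $Z\sim\mathbb{P}_{\mathrm E}(0,1,\hat g)$. The reference distribution $\mathbb{P}_\zeta$ is assumed sub-Gaussian. DRCCP: $v^*=\min\{c^\top x:x\in\mathcal X,\ \mathbb{P}_\zeta\{\theta\|x\|_*+x^\top\tilde\zeta\le b_1\}\ge1-\varepsilon\}$. ALSO-X#: $v^{A\#}$ is the minimum (infimum) of all $t$ for which there is $(x^*,\beta^* )\in\arg\min\{\varepsilon\beta+\mathbb{E}_{\mathbb{P}_\zeta}[(\theta\|x\|_*+x^\top\tilde\zeta-b_1-\beta)_+]:x\in\mathcal X,\ c^\top x\le t,\ \beta\le0\}$ with $\mathbb{P}_\zeta\{\theta\|x^*\|_*+(x^* )^\top\tilde\zeta\le b_1\}\ge1-\varepsilon$. An infimum over the empty set is $+\infty$. *)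

theory Defs
  imports "HOL-Probability.Probability"
begin

definition diag_mat :: "real ^ 'n \<Rightarrow> real ^ 'n ^ 'n" where
  "diag_mat \<mu> = (\<chi> i j. if i = j then \<mu> $ i else 0)"

definition psd_mat :: "real ^ 'n ^ 'n \<Rightarrow> bool" where
  "psd_mat S \<longleftrightarrow> transpose S = S \<and> (\<forall>x. 0 \<le> x \<bullet> (S *v x))"

(* Dual of the generalized Mahalanobis norm sqrt (y^T S^+ y); for singular S it is only a
   seminorm. *)
definition mahalanobis_dual_norm :: "real ^ 'n ^ 'n \<Rightarrow> real ^ 'n \<Rightarrow> real" where
  "mahalanobis_dual_norm S x = sqrt (x \<bullet> (S *v x))"

(* Only the values of g on the nonnegative half-line matter. *)
definition generating_function :: "(real \<Rightarrow> real) \<Rightarrow> bool" where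
  "generating_function g \<longleftrightarrow>
     (\<forall>u\<ge>0. 0 \<le> g u) \<and> integrable lborel (\<lambda>z. g (z\<^sup>2 / 2)) \<and>
     0 < (LINT z|lborel. g (z\<^sup>2 / 2))"

definition std_elliptical_density :: "(real \<Rightarrow> real) \<Rightarrow> real \<Rightarrow> real" where
  "std_elliptical_density g z = inverse (LINT w|lborel. g (w\<^sup>2 / 2)) * g (z\<^sup>2 / 2)"

definition std_elliptical :: "(real \<Rightarrow> real) \<Rightarrow> real measure" where
  "std_elliptical g = density lborel (\<lambda>z. ennreal (std_elliptical_density g z))"

lemma prob_space_std_elliptical:
  assumes "generating_function g"
  shows "prob_space (std_elliptical g)"
proof
  let ?c = "LINT w|lborel. g (w\<^sup>2 / 2)"
  have i: "integrable lborel (\<lambda>z. g (z\<^sup>2 / 2))" and p: "0 < ?c"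
    and nn: "\<And>z. 0 \<le> g (z\<^sup>2 / 2)"
    using assms by (auto simp: generating_function_def)
  have m: "std_elliptical_density g \<in> borel_measurable lborel"
    using borel_measurable_integrable[OF i] unfolding std_elliptical_density_def by measurable
  have "emeasure (std_elliptical g) (space (std_elliptical g)) =
      (\<integral>\<^sup>+z. ennreal (std_elliptical_density g z) \<partial>lborel)"
    using m by (simp add: std_elliptical_def emeasure_density)
  also have "\<dots> = ennreal (LINT z|lborel. std_elliptical_density g z)"
    using i nn p
    by (intro nn_integral_eq_integral) (auto simp: std_elliptical_density_def)
  also have "\<dots> = 1" using p by (simp add: std_elliptical_density_def)
  finally show "emeasure (std_elliptical g) (space (std_elliptical g)) = 1" .
qed

lemma cdf_std_elliptical:
  assumes "generating_function g"
  shows "cdf (std_elliptical g) t = (LINT z:{..t}|lborel. std_elliptical_density g z)"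
proof -
  let ?c = "LINT w|lborel. g (w\<^sup>2 / 2)"
  have i: "integrable lborel (\<lambda>z. g (z\<^sup>2 / 2))" and p: "0 < ?c"
    and nn: "\<And>z. 0 \<le> g (z\<^sup>2 / 2)"
    using assms by (auto simp: generating_function_def)
  have id: "integrable lborel (std_elliptical_density g)"
    using i unfolding std_elliptical_density_def by auto
  have nd: "\<And>z. 0 \<le> std_elliptical_density g z"
    using nn p by (simp add: std_elliptical_density_def)
  have "emeasure (std_elliptical g) {..t} =
      (\<integral>\<^sup>+z. ennreal (indicator {..t} z * std_elliptical_density g z) \<partial>lborel)"
    using borel_measurable_integrable[OF id]
    by (auto simp: std_elliptical_def emeasure_density intro!: nn_integral_cong
          split: split_indicator)
  also have "\<dots> = ennreal (LINT z:{..t}|lborel. std_elliptical_density g z)"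
    unfolding set_lebesgue_integral_def using id nd
    by (subst nn_integral_eq_integral)
       (auto intro!: integrable_mult_indicator[where 'b = real, simplified])
  finally show ?thesis
    using nd unfolding cdf_def measure_def set_lebesgue_integral_def
    by (simp add: integral_nonneg_AE)
qed

(* Generalized inverse of the distribution function of a real law, which need not be strictly
   increasing. *)
definition quantile :: "real measure \<Rightarrow> real \<Rightarrow> real" where
  "quantile M p = Inf {\<tau>. p \<le> cdf M \<tau>}"

(* The generating function g is that of the one-dimensional projections, and for singular S
   the law is determined by these projections alone. For invertible S the law also has an
   elliptically contoured density. Its generator h must be allowed to differ from g: the
   density generator depends on the dimension, and h = g in dimension at least 2 would leave
   only Gaussian laws. *)
definition elliptical ::
  "real ^ 'n \<Rightarrow> real ^ 'n ^ 'n \<Rightarrow> (real \<Rightarrow> real) \<Rightarrow> (real ^ 'n) measure \<Rightarrow> bool" where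
  "elliptical \<mu> S g P \<longleftrightarrow>
     prob_space P \<and> sets P = sets borel \<and> psd_mat S \<and> generating_function g \<and>
     (\<forall>x. distr P borel (\<lambda>\<zeta>. x \<bullet> \<zeta>) =
          distr (std_elliptical g) borel (\<lambda>z. \<mu> \<bullet> x + sqrt (x \<bullet> (S *v x)) * z)) \<and>
     (invertible S \<longrightarrow>
        (\<exists>h k. (\<forall>u\<ge>0. 0 \<le> h u) \<and> 0 < k \<and>
           (\<lambda>y. h ((y - \<mu>) \<bullet> (matrix_inv S *v (y - \<mu>)) / 2)) \<in> borel_measurable borel \<and>
           P = density lborel
                 (\<lambda>y. ennreal (k * h ((y - \<mu>) \<bullet> (matrix_inv S *v (y - \<mu>)) / 2)))))"

definition sub_gaussian :: "'a::real_normed_vector measure \<Rightarrow> bool" where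
  "sub_gaussian P \<longleftrightarrow>
     (\<exists>C1>0. \<exists>C2>0. \<forall>t\<ge>0. \<P>(\<zeta> in P. t \<le> norm \<zeta>) \<le> C1 * exp (- C2 * t\<^sup>2))"

definition chance_feasible ::
  "(real ^ 'n) measure \<Rightarrow> real ^ 'n ^ 'n \<Rightarrow> real \<Rightarrow> real \<Rightarrow> real \<Rightarrow> real ^ 'n \<Rightarrow> bool" where
  "chance_feasible P S \<theta> b \<epsilon> x \<longleftrightarrow>
     \<P>(\<zeta> in P. \<theta> * mahalanobis_dual_norm S x + x \<bullet> \<zeta> \<le> b) \<ge> 1 - \<epsilon>"

(* Optimal values are extended reals, so that an infeasible problem has value infinity. *)
definition drccp_value ::
  "(real ^ 'n) measure \<Rightarrow> real ^ 'n ^ 'n \<Rightarrow> real \<Rightarrow> real \<Rightarrow> real \<Rightarrow> (real ^ 'n) set \<Rightarrow> real ^ 'n \<Rightarrow> ereal"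
  where
  "drccp_value P S \<theta> b \<epsilon> X c = (INF x\<in>{x \<in> X. chance_feasible P S \<theta> b \<epsilon> x}. ereal (c \<bullet> x))"

definition alsox_sharp_objective ::
  "(real ^ 'n) measure \<Rightarrow> real ^ 'n ^ 'n \<Rightarrow> real \<Rightarrow> real \<Rightarrow> real \<Rightarrow> (real ^ 'n) \<times> real \<Rightarrow> real" where
  "alsox_sharp_objective P S \<theta> b \<epsilon> = (\<lambda>(x, \<beta>).
     \<epsilon> * \<beta> + (LINT \<zeta>|P. max (\<theta> * mahalanobis_dual_norm S x + x \<bullet> \<zeta> - b - \<beta>) 0))"

definition alsox_sharp_value ::
  "(real ^ 'n) measure \<Rightarrow> real ^ 'n ^ 'n \<Rightarrow> real \<Rightarrow> real \<Rightarrow> real \<Rightarrow> (real ^ 'n) set \<Rightarrow> real ^ 'n \<Rightarrow> ereal"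
  where
  "alsox_sharp_value P S \<theta> b \<epsilon> X c =
     (INF t\<in>{t. \<exists>x' \<beta>'.
          is_arg_min (alsox_sharp_objective P S \<theta> b \<epsilon>)
            (\<lambda>(x, \<beta>). x \<in> X \<and> c \<bullet> x \<le> t \<and> \<beta> \<le> 0) (x', \<beta>') \<and>
          chance_feasible P S \<theta> b \<epsilon> x'}. ereal t)"

end

theory Submission
  imports Defs
begin

text \<open>
  On binary vectors the quadratic form of \<^term>\<open>diag_mat \<mu>\<close> is linear, because
  \<open>x\<^sub>i\<^sup>2 = x\<^sub>i\<close>.  So the location and the dispersion of the projection \<open>x \<bullet> \<zeta>\<close> are
  governed by a single number: with \<open>r = sqrt (\<mu> \<bullet> x)\<close>, the robust loss
  \<open>\<theta> * r + x \<bullet> \<zeta>\<close> has the law of \<open>r\<^sup>2 + r * (\<theta> + Z)\<close>, where \<open>Z\<close> is standard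
  elliptical.  Both problems prefer a small \<open>r\<close>:

  \<^item> The chance constraint reads \<open>r\<^sup>2 + r * (\<theta> + q) \<le> b\<close>, where \<open>q\<close> is the quantile of \<open>Z\<close> at
    level \<open>1 - \<epsilon>\<close> (\<open>elliptical_chance_feasible_iff\<close>).  The left-hand side increases with \<open>r\<close>
    since \<open>\<theta> + q \<ge> 0\<close>.

  \<^item> For each fixed \<open>\<beta>\<close> the ALSO-X# objective increases with \<open>r\<close>
    (\<open>alsox_sharp_objective_mono\<close>).  Since \<open>Z\<close> is symmetric, the expectation of the positive part
    of \<open>a + r * Z\<close> is half that of \<open>(a + r * Z)\<^sub>+ + (a - r * Z)\<^sub>+\<close>, which pointwise
    increases with \<open>a\<close> and with \<open>r \<ge> 0\<close>.

  Now let \<open>y\<close> satisfy the chance constraint and put \<open>t = c \<bullet> y\<close>.  Among the finitely many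
  \<open>x \<in> X\<close> with \<open>c \<bullet> x \<le> t\<close>, one of least \<open>r\<close>, together with a best \<open>\<beta> \<le> 0\<close> for it, minimizes
  the ALSO-X# objective, and it inherits the chance constraint from \<open>y\<close>.  Hence \<open>t\<close> is admissible
  for ALSO-X#.  The converse inequality between the two values holds in general, because every
  admissible \<open>t\<close> comes with a feasible point of cost at most \<open>t\<close>.

  The sub-Gaussian tail makes the expectations genuine: it gives \<open>Z\<close> a first moment
  (unless all projections are degenerate), and a best \<open>\<beta>\<close> exists by continuity and coercivity.
\<close>

section \<open>Quantiles\<close>

text \<open>The infimum in the quantile is attained because distribution functions are continuous from the
  right.  The limits 0 and 1 of a distribution function at the two infinities make it the infimum of
  a nonempty set bounded below.\<close>
lemma quantile_le_iff:
  assumes "real_distribution M" "0 < p" "p < 1"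
  shows "quantile M p \<le> \<tau> \<longleftrightarrow> p \<le> cdf M \<tau>"
proof -
  interpret real_distribution M by fact
  let ?A = "{\<tau>. p \<le> cdf M \<tau>}"
  have "eventually (\<lambda>x. p < cdf M x) at_top"
    using order_tendstoD(1)[OF cdf_lim_at_top_prob] assms by simp
  then obtain u where "p < cdf M u"
    by (meson eventually_happens' trivial_limit_at_top_linorder)
  then have ne: "?A \<noteq> {}" using less_imp_le by blast
  have "eventually (\<lambda>x. cdf M x < p) at_bot"
    using order_tendstoD(2)[OF cdf_lim_at_bot] assms by simp
  then obtain l where l: "cdf M l < p"
    by (meson eventually_happens' trivial_limit_at_bot_linorder)
  have bdd: "bdd_below ?A"
  proof (rule bdd_belowI)
    fix x assume "x \<in> ?A"
    then have "\<not> cdf M x \<le> cdf M l" using l by simp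
    then show "l \<le> x" using cdf_nondecreasing[of x l] by linarith
  qed
  have above: "p \<le> cdf M x" if "Inf ?A < x" for x
  proof -
    obtain u where "p \<le> cdf M u" "u < x" using cInf_less_iff[OF ne bdd] \<open>Inf ?A < x\<close> by auto
    then show ?thesis using cdf_nondecreasing[of u x] by linarith
  qed
  have "p \<le> cdf M (Inf ?A)"
  proof (rule tendsto_lowerbound)
    show "(cdf M \<longlongrightarrow> cdf M (Inf ?A)) (at_right (Inf ?A))"
      using cdf_is_right_cont by (simp add: continuous_within)
    show "eventually (\<lambda>x. p \<le> cdf M x) (at_right (Inf ?A))"
      using above by (auto simp: eventually_at_filter)
  qed simp
  then have "p \<le> cdf M \<tau>" if "Inf ?A \<le> \<tau>" using cdf_nondecreasing[OF that] by (rule order_trans)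
  moreover have "Inf ?A \<le> \<tau>" if "p \<le> cdf M \<tau>" using that by (intro cInf_lower bdd) simp
  ultimately show ?thesis unfolding quantile_def by blast
qed

section \<open>Expected positive parts under symmetric laws\<close>

text \<open>The map \<open>s \<mapsto> (a + s)\<^sub>+ + (a - s)\<^sub>+\<close> is convex and even, hence increasing in \<open>\<bar>s\<bar>\<close>.\<close>
lemma positive_part_symmetrized_mono:
  fixes a a' s s' :: real
  assumes "a \<le> a'" "\<bar>s\<bar> \<le> \<bar>s'\<bar>"
  shows "max (a + s) 0 + max (a - s) 0 \<le> max (a' + s') 0 + max (a' - s') 0"
  using assms by (auto simp: max_def abs_if split: if_splits)

text \<open>Spreading out a symmetric law increases the expectation of a convex function; a positive part
  also increases under a shift to the right.\<close>
lemma expected_positive_part_mono: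
  fixes M :: "real measure"
  assumes prob: "prob_space M" and sym: "distr M borel uminus = M"
    and int: "integrable M (\<lambda>z. z)"
    and le: "a \<le> a'" "0 \<le> s" "s \<le> s'"
  shows "(LINT z|M. max (a + s * z) 0) \<le> (LINT z|M. max (a' + s' * z) 0)"
proof -
  interpret prob_space M by fact
  have sets: "sets M = sets borel" using sym by (metis sets_distr)
  have I [simp]: "integrable M (\<lambda>z. max (a + s * z) 0)" for a s
    using int by (intro integrable_max) auto
  have I' [simp]: "integrable M (\<lambda>z. max (a - s * z) 0)" for a s
    using int by (intro integrable_max) auto
  have two: "2 * (LINT z|M. max (a + s * z) 0) =
      (LINT z|M. max (a + s * z) 0 + max (a - s * z) 0)" for a s
  proof -
    have "(LINT z|M. max (a + s * z) 0) = (LINT z|distr M borel uminus. max (a + s * z) 0)"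
      by (simp add: sym)
    also have "\<dots> = (LINT z|M. max (a - s * z) 0)"
      using sets by (subst integral_distr) (auto simp: measurable_cong_sets[OF sets refl])
    finally show ?thesis by simp
  qed
  have "2 * (LINT z|M. max (a + s * z) 0) \<le> 2 * (LINT z|M. max (a' + s' * z) 0)"
    unfolding two using le
    by (intro integral_mono positive_part_symmetrized_mono)
       (auto simp: abs_mult intro: mult_right_mono)
  then show ?thesis by simp
qed

text \<open>The function \<open>\<beta> \<mapsto> \<epsilon> * \<beta> + E (Y - \<beta>)\<^sub>+\<close> is continuous and bounded below by
  \<open>E Y - (1 - \<epsilon>) * \<beta>\<close>, which tends to infinity as \<open>\<beta>\<close> decreases.\<close>
lemma expected_excess_attained:
  fixes Y :: "'a \<Rightarrow> real"
  assumes prob: "prob_space P" and Y: "integrable P Y" and \<epsilon>: "\<epsilon> < 1"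
  defines "F \<equiv> \<lambda>\<beta>. \<epsilon> * \<beta> + (LINT \<zeta>|P. max (Y \<zeta> - \<beta>) 0)"
  shows "\<exists>\<beta>\<le>0. \<forall>\<beta>'\<le>0. F \<beta> \<le> F \<beta>'"
proof -
  interpret prob_space P by fact
  define E where "E \<beta> = (LINT \<zeta>|P. max (Y \<zeta> - \<beta>) 0)" for \<beta>
  have I [simp]: "integrable P (\<lambda>\<zeta>. max (Y \<zeta> - \<beta>) 0)" for \<beta>
    using Y by (intro integrable_max) auto
  have "E \<beta> \<le> E \<beta>' + \<bar>\<beta> - \<beta>'\<bar>" for \<beta> \<beta>'
  proof -
    have "E \<beta> \<le> (LINT \<zeta>|P. max (Y \<zeta> - \<beta>') 0 + \<bar>\<beta> - \<beta>'\<bar>)"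
      unfolding E_def by (intro integral_mono) auto
    then show ?thesis by (simp add: E_def prob_space)
  qed
  then have "\<bar>E \<beta> - E \<beta>'\<bar> \<le> \<bar>\<beta> - \<beta>'\<bar>" for \<beta> \<beta>'
    by (smt (verit, best))
  then have "1-lipschitz_on UNIV E"
    by (auto simp: lipschitz_on_def dist_real_def)
  then have cont: "continuous_on A F" for A
    unfolding F_def E_def[symmetric]
    by (intro continuous_intros continuous_on_subset[OF lipschitz_on_continuous_on]) auto
  have low: "expectation Y - (1 - \<epsilon>) * \<beta> \<le> F \<beta>" for \<beta>
  proof -
    have "expectation Y - \<beta> = (LINT \<zeta>|P. Y \<zeta> - \<beta>)" using Y by (simp add: prob_space)
    also have "\<dots> \<le> E \<beta>" unfolding E_def using Y by (intro integral_mono) auto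
    finally show ?thesis by (simp add: F_def E_def algebra_simps)
  qed
  \<comment> \<open>Left of \<open>-K\<close> the lower bound already exceeds the value at 0.\<close>
  define K where "K = \<bar>F 0 - expectation Y\<bar> / (1 - \<epsilon>)"
  have K0: "0 \<le> K" using \<epsilon> by (simp add: K_def)
  obtain \<beta> where \<beta>: "\<beta> \<in> {-K..0}" "\<And>\<beta>'. \<beta>' \<in> {-K..0} \<Longrightarrow> F \<beta> \<le> F \<beta>'"
    using continuous_attains_inf[of "{-K..0}" F] cont K0 by auto
  have "F \<beta> \<le> F \<beta>'" if "\<beta>' \<le> 0" for \<beta>'
  proof (cases "-K \<le> \<beta>'")
    case False
    then have "K * (1 - \<epsilon>) \<le> - \<beta>' * (1 - \<epsilon>)"
      using \<epsilon> by (intro mult_right_mono) auto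
    moreover have "K * (1 - \<epsilon>) = \<bar>F 0 - expectation Y\<bar>" using \<epsilon> by (simp add: K_def)
    ultimately have "F 0 \<le> F \<beta>'" using low[of \<beta>'] by (simp add: algebra_simps)
    then show ?thesis using \<beta>(2)[of 0] K0 by simp
  qed (use \<beta> that in auto)
  then show ?thesis using \<beta>(1) by auto
qed

section \<open>Sub-Gaussian and elliptical laws\<close>

text \<open>The expectation of the integer part of the norm is the sum of the tail probabilities at
  the positive integers, which a geometric series dominates.\<close>
lemma sub_gaussian_integrable_norm:
  fixes P :: "'a::{real_normed_vector, second_countable_topology} measure"
  assumes prob: "prob_space P" and sets: "sets P = sets borel" and sg: "sub_gaussian P"
  shows "integrable P norm"
proof -
  interpret prob_space P by fact
  obtain C1 C2 where C: "0 < C1" "0 < C2"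
    and tail: "\<And>t. 0 \<le> t \<Longrightarrow> \<P>(\<zeta> in P. t \<le> norm \<zeta>) \<le> C1 * exp (- C2 * t\<^sup>2)"
    using sg unfolding sub_gaussian_def by auto
  have m [measurable]: "norm \<in> borel_measurable P"
    using borel_measurable_norm by (simp add: measurable_cong_sets[OF sets refl])
  define N where "N \<zeta> = nat \<lfloor>norm \<zeta>\<rfloor>" for \<zeta> :: 'a
  have [measurable]: "N \<in> measurable P (count_space UNIV)" unfolding N_def by measurable
  have summ: "summable (\<lambda>n. C1 * exp (- C2) ^ n)"
    using C by (intro summable_mult summable_geometric) auto
  have bound: "emeasure P {\<zeta> \<in> space P. n < N \<zeta>} \<le> ennreal (C1 * exp (- C2) ^ n)" for n
  proof -
    have "emeasure P {\<zeta> \<in> space P. n < N \<zeta>} \<le> emeasure P {\<zeta> \<in> space P. real n \<le> norm \<zeta>}"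
    proof (rule emeasure_mono)
      show "{\<zeta> \<in> space P. n < N \<zeta>} \<subseteq> {\<zeta> \<in> space P. real n \<le> norm \<zeta>}"
        unfolding N_def by auto linarith
    qed measurable
    also have "\<dots> = ennreal (\<P>(\<zeta> in P. real n \<le> norm \<zeta>))" by (simp add: emeasure_eq_measure)
    also have "\<dots> \<le> ennreal (C1 * exp (- C2) ^ n)"
    proof (rule ennreal_leI)
      \<comment> \<open>The quadratic exponent is weakened to a linear one to obtain a geometric series.\<close>
      have "real n \<le> (real n)\<^sup>2"
        by (metis of_nat_le_iff of_nat_power le_square power2_eq_square)
      then have "exp (- C2 * (real n)\<^sup>2) \<le> exp (- C2) ^ n"
        using C by (simp add: exp_of_nat_mult[symmetric] mult.commute)
      then show "\<P>(\<zeta> in P. real n \<le> norm \<zeta>) \<le> C1 * exp (- C2) ^ n"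
        using tail[of "real n"] C by (smt (verit) mult_left_mono of_nat_0_le_iff)
    qed
    finally show ?thesis .
  qed
  have "(\<integral>\<^sup>+\<zeta>. ennreal (norm (norm \<zeta>)) \<partial>P) \<le> (\<integral>\<^sup>+\<zeta>. 1 + of_nat (N \<zeta>) \<partial>P)"
  proof (rule nn_integral_mono)
    fix \<zeta>
    have "norm \<zeta> \<le> 1 + real (N \<zeta>)" unfolding N_def by linarith
    then have "ennreal (norm \<zeta>) \<le> ennreal (1 + real (N \<zeta>))" by (rule ennreal_leI)
    then show "ennreal (norm (norm \<zeta>)) \<le> 1 + of_nat (N \<zeta>)"
      by (simp add: ennreal_of_nat_eq_real_of_nat)
  qed
  also have "\<dots> = 1 + (\<Sum>n. emeasure P {\<zeta> \<in> space P. n < N \<zeta>})"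
    by (subst nn_integral_add) (auto simp: nn_integral_nat_function emeasure_space_1)
  also have "\<dots> \<le> 1 + (\<Sum>n. ennreal (C1 * exp (- C2) ^ n))"
    by (intro add_left_mono suminf_le bound) auto
  also have "\<dots> < \<infinity>"
    using summ C by (simp add: suminf_ennreal2 ennreal_add_eq_top less_top)
  finally show ?thesis by (intro integrableI_bounded) (use m in auto)
qed

lemma sets_std_elliptical [simp, measurable_cong]: "sets (std_elliptical g) = sets borel"
  by (simp add: std_elliptical_def)

lemma real_distribution_std_elliptical:
  assumes "generating_function g"
  shows "real_distribution (std_elliptical g)"
proof -
  interpret prob_space "std_elliptical g" using assms by (rule prob_space_std_elliptical)
  show ?thesis by standard simp
qed

lemma std_elliptical_symmetric:
  assumes "generating_function g"
  shows "distr (std_elliptical g) borel uminus = std_elliptical g"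
proof -
  have [measurable]: "std_elliptical_density g \<in> borel_measurable borel"
    using assms borel_measurable_integrable[of lborel "\<lambda>z. g (z\<^sup>2 / 2)"]
    unfolding std_elliptical_density_def generating_function_def by simp
  have "density (distr lborel borel uminus) (\<lambda>z. ennreal (std_elliptical_density g z)) =
      distr (density lborel (\<lambda>z. ennreal (std_elliptical_density g (- z)))) borel uminus"
    by (subst density_distr) auto
  then show ?thesis
    by (simp add: lborel_distr_uminus std_elliptical_def std_elliptical_density_def)
qed

lemma elliptical_projection:
  assumes "elliptical \<mu> S g P"
  shows "distr P borel (\<lambda>\<zeta>. x \<bullet> \<zeta>) =
      distr (std_elliptical g) borel (\<lambda>z. \<mu> \<bullet> x + sqrt (x \<bullet> (S *v x)) * z)"
  using assms by (simp add: elliptical_def)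

lemma elliptical_integral_projection:
  assumes ell: "elliptical \<mu> S g P" and [measurable]: "f \<in> borel_measurable borel"
  shows "(LINT \<zeta>|P. f (x \<bullet> \<zeta>)) =
      (LINT z|std_elliptical g. (f (\<mu> \<bullet> x + sqrt (x \<bullet> (S *v x)) * z) :: real))"
proof -
  have [measurable_cong]: "sets P = sets borel" using ell by (simp add: elliptical_def)
  have "(LINT \<zeta>|P. f (x \<bullet> \<zeta>)) = (LINT y|distr P borel (\<lambda>\<zeta>. x \<bullet> \<zeta>). f y)"
    by (subst integral_distr) auto
  also have "\<dots> = (LINT z|std_elliptical g. f (\<mu> \<bullet> x + sqrt (x \<bullet> (S *v x)) * z))"
    unfolding elliptical_projection[OF ell] by (subst integral_distr) auto
  finally show ?thesis .
qed

lemma elliptical_projection_integrable: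
  assumes ell: "elliptical \<mu> S g P" and sg: "sub_gaussian P"
  shows "integrable P (\<lambda>\<zeta>. x \<bullet> \<zeta>)"
proof (rule Bochner_Integration.integrable_bound)
  have sets [measurable_cong]: "sets P = sets borel" and "prob_space P"
    using ell by (simp_all add: elliptical_def)
  then show "integrable P (\<lambda>\<zeta>. norm x * norm \<zeta>)"
    using sub_gaussian_integrable_norm[OF _ _ sg] by simp
  show "(\<lambda>\<zeta>. x \<bullet> \<zeta>) \<in> borel_measurable P" by measurable
  show "AE \<zeta> in P. norm (x \<bullet> \<zeta>) \<le> norm (norm x * norm \<zeta>)"
    by (simp add: Cauchy_Schwarz_ineq2)
qed

text \<open>One nondegenerate projection suffices to carry the first moment of \<open>P\<close> over to the standard
  law, as the two differ by an invertible affine map.\<close>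
lemma elliptical_std_integrable:
  assumes ell: "elliptical \<mu> S g P" and sg: "sub_gaussian P" and pos: "0 < x \<bullet> (S *v x)"
  shows "integrable (std_elliptical g) (\<lambda>z. z)"
proof -
  let ?r = "sqrt (x \<bullet> (S *v x))"
  have [measurable_cong]: "sets P = sets borel" using ell by (simp add: elliptical_def)
  interpret real_distribution "std_elliptical g"
    using ell by (intro real_distribution_std_elliptical) (simp add: elliptical_def)
  have "integrable (distr P borel (\<lambda>\<zeta>. x \<bullet> \<zeta>)) (\<lambda>y. y)"
    using elliptical_projection_integrable[OF ell sg] by (subst integrable_distr_eq) auto
  then have "integrable (std_elliptical g) (\<lambda>z. \<mu> \<bullet> x + ?r * z)"
    unfolding elliptical_projection[OF ell] by (subst (asm) integrable_distr_eq) auto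
  then have "integrable (std_elliptical g) (\<lambda>z. (\<mu> \<bullet> x + ?r * z) - \<mu> \<bullet> x)"
    by (rule Bochner_Integration.integrable_diff) simp
  then show ?thesis using pos by simp
qed

text \<open>The quantile commutes with increasing affine maps.  A degenerate projection, whose law is a
  point mass, satisfies the same formula since \<open>0 < 1 - \<epsilon> < 1\<close>.\<close>
lemma elliptical_chance_feasible_iff:
  assumes ell: "elliptical \<mu> S g P" and \<epsilon>: "0 < \<epsilon>" "\<epsilon> < 1"
  defines "q \<equiv> quantile (std_elliptical g) (1 - \<epsilon>)"
  shows "chance_feasible P S \<theta> b \<epsilon> x \<longleftrightarrow>
    \<mu> \<bullet> x + mahalanobis_dual_norm S x * (\<theta> + q) \<le> b"
proof -
  let ?r = "mahalanobis_dual_norm S x"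
  have [measurable_cong]: "sets P = sets borel" using ell by (simp add: elliptical_def)
  have sp: "space P = UNIV" using sets_eq_imp_space_eq[of P borel] ell by (simp add: elliptical_def)
  have rd: "real_distribution (std_elliptical g)"
    using ell by (intro real_distribution_std_elliptical) (simp add: elliptical_def)
  interpret real_distribution "std_elliptical g" by fact
  have r0: "0 \<le> ?r" using ell by (simp add: mahalanobis_dual_norm_def elliptical_def psd_mat_def)
  have "\<P>(\<zeta> in P. \<theta> * ?r + x \<bullet> \<zeta> \<le> b) = measure (distr P borel (\<lambda>\<zeta>. x \<bullet> \<zeta>)) {.. b - \<theta> * ?r}"
    by (subst measure_distr) (auto simp: sp intro!: arg_cong[where f = "measure P"])
  also have "\<dots> = prob {z. \<mu> \<bullet> x + ?r * z \<le> b - \<theta> * ?r}"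
    unfolding elliptical_projection[OF ell] mahalanobis_dual_norm_def
    by (subst measure_distr) (auto intro!: arg_cong[where f = prob])
  finally have law: "\<P>(\<zeta> in P. \<theta> * ?r + x \<bullet> \<zeta> \<le> b) = prob {z. \<mu> \<bullet> x + ?r * z \<le> b - \<theta> * ?r}" .
  show ?thesis
  proof (cases "?r = 0")
    case True
    have "prob UNIV = 1" using prob_space by simp
    with True law \<epsilon> show ?thesis by (auto simp: chance_feasible_def)
  next
    case False
    with r0 have r: "0 < ?r" by simp
    have "{z. \<mu> \<bullet> x + ?r * z \<le> b - \<theta> * ?r} = {.. (b - \<mu> \<bullet> x) / ?r - \<theta>}"
      using r by (auto simp: field_simps)
    then have "chance_feasible P S \<theta> b \<epsilon> x \<longleftrightarrow>
        1 - \<epsilon> \<le> cdf (std_elliptical g) ((b - \<mu> \<bullet> x) / ?r - \<theta>)"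
      by (simp add: chance_feasible_def law cdf_def)
    also have "\<dots> \<longleftrightarrow> q \<le> (b - \<mu> \<bullet> x) / ?r - \<theta>"
      unfolding q_def using \<epsilon> by (subst quantile_le_iff[OF rd]) auto
    also have "\<dots> \<longleftrightarrow> \<mu> \<bullet> x + ?r * (\<theta> + q) \<le> b" using r by (simp add: field_simps)
    finally show ?thesis .
  qed
qed

lemma elliptical_alsox_sharp_objective:
  assumes ell: "elliptical \<mu> S g P"
  defines "r \<equiv> mahalanobis_dual_norm S"
  shows "alsox_sharp_objective P S \<theta> b \<epsilon> (x, \<beta>) = \<epsilon> * \<beta> +
    (LINT z|std_elliptical g. max ((\<mu> \<bullet> x + \<theta> * r x - b - \<beta>) + r x * z) 0)"
proof -
  have "(LINT \<zeta>|P. max (\<theta> * r x + x \<bullet> \<zeta> - b - \<beta>) 0) =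
      (LINT z|std_elliptical g. max (\<theta> * r x + (\<mu> \<bullet> x + r x * z) - b - \<beta>) 0)"
    using elliptical_integral_projection[OF ell, of "\<lambda>y. max (\<theta> * r x + y - b - \<beta>) 0" x]
    by (simp add: r_def mahalanobis_dual_norm_def)
  then show ?thesis by (simp add: alsox_sharp_objective_def r_def algebra_simps)
qed

text \<open>If the larger dual norm vanishes, both projections are degenerate and the integrals compare
  directly; otherwise the standard law has a first moment and its symmetry yields the comparison.\<close>
lemma alsox_sharp_objective_mono:
  assumes ell: "elliptical \<mu> S g P" and sg: "sub_gaussian P" and \<theta>: "0 \<le> \<theta>"
    and m: "\<mu> \<bullet> x \<le> \<mu> \<bullet> y" and r: "mahalanobis_dual_norm S x \<le> mahalanobis_dual_norm S y"
  shows "alsox_sharp_objective P S \<theta> b \<epsilon> (x, \<beta>) \<le> alsox_sharp_objective P S \<theta> b \<epsilon> (y, \<beta>)"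
proof -
  let ?r = "mahalanobis_dual_norm S"
  have psd: "0 \<le> u \<bullet> (S *v u)" for u using ell by (simp add: elliptical_def psd_mat_def)
  then have r0: "0 \<le> ?r u" for u by (simp add: mahalanobis_dual_norm_def)
  have gen: "generating_function g" using ell by (simp add: elliptical_def)
  interpret prob_space "std_elliptical g" using gen by (rule prob_space_std_elliptical)
  have le: "\<mu> \<bullet> x + \<theta> * ?r x - b - \<beta> \<le> \<mu> \<bullet> y + \<theta> * ?r y - b - \<beta>"
    using m mult_left_mono[OF r \<theta>] by simp
  have "(LINT z|std_elliptical g. max ((\<mu> \<bullet> x + \<theta> * ?r x - b - \<beta>) + ?r x * z) 0)
      \<le> (LINT z|std_elliptical g. max ((\<mu> \<bullet> y + \<theta> * ?r y - b - \<beta>) + ?r y * z) 0)"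
  proof (cases "?r y = 0")
    case True
    then have "?r x = 0" using r r0[of x] by simp
    with True m show ?thesis by (simp add: prob_space)
  next
    case False
    then have "0 < y \<bullet> (S *v y)" using psd[of y] by (simp add: mahalanobis_dual_norm_def)
    then show ?thesis
      using expected_positive_part_mono[OF prob_space_axioms std_elliptical_symmetric[OF gen]
        elliptical_std_integrable[OF ell sg] le r0 r] by blast
  qed
  then show ?thesis unfolding elliptical_alsox_sharp_objective[OF ell] by simp
qed

lemma alsox_sharp_threshold_attained:
  assumes ell: "elliptical \<mu> S g P" and sg: "sub_gaussian P" and \<epsilon>: "\<epsilon> < 1"
  shows "\<exists>\<beta>\<le>0. \<forall>\<beta>'\<le>0.
    alsox_sharp_objective P S \<theta> b \<epsilon> (x, \<beta>) \<le> alsox_sharp_objective P S \<theta> b \<epsilon> (x, \<beta>')"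
proof -
  have prob: "prob_space P" using ell by (simp add: elliptical_def)
  then interpret prob_space P .
  have "integrable P (\<lambda>\<zeta>. \<theta> * mahalanobis_dual_norm S x + x \<bullet> \<zeta> - b)"
    using elliptical_projection_integrable[OF ell sg] by simp
  from expected_excess_attained[OF prob this \<epsilon>] show ?thesis
    by (simp add: alsox_sharp_objective_def)
qed

section \<open>Exactness\<close>

lemma finite_binary_vectors: "finite {x :: real ^ 'n. \<forall>i. x $ i \<in> {0, 1}}"
proof (rule finite_subset)
  show "{x :: real ^ 'n. \<forall>i. x $ i \<in> {0, 1}} \<subseteq> vec_lambda ` Pi UNIV (\<lambda>_. {0, 1})"
    by (auto intro!: image_eqI[of _ _ "\<lambda>i. x $ i" for x])
  show "finite (vec_lambda ` Pi (UNIV :: 'n set) (\<lambda>_. {0, 1 :: real}))"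
    using finite_PiE[of "UNIV :: 'n set" "\<lambda>_. {0, 1 :: real}"] by (simp add: PiE_UNIV_domain)
qed

text \<open>This is where binary vectors enter: they tie the dispersion to the location.\<close>
lemma diag_mat_quadratic_form_binary:
  assumes "\<forall>i. x $ i \<in> {0, 1 :: real}"
  shows "x \<bullet> (diag_mat \<mu> *v x) = \<mu> \<bullet> x"
proof -
  have "x $ i * (diag_mat \<mu> *v x) $ i = \<mu> $ i * x $ i" for i
  proof -
    have "(diag_mat \<mu> *v x) $ i = \<mu> $ i * x $ i"
      by (simp add: diag_mat_def matrix_vector_mult_def if_distrib[of "\<lambda>u. u * _"] cong: if_cong)
    then show ?thesis using assms[rule_format, of i] by auto
  qed
  then show ?thesis by (simp only: inner_vec_def inner_real_def)
qed

lemma drccp_value_le_alsox_sharp_value: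
  "drccp_value P S \<theta> b \<epsilon> X c \<le> alsox_sharp_value P S \<theta> b \<epsilon> X c"
  unfolding alsox_sharp_value_def
proof (rule INF_greatest)
  fix t assume "t \<in> {t. \<exists>x' \<beta>'.
      is_arg_min (alsox_sharp_objective P S \<theta> b \<epsilon>)
        (\<lambda>(x, \<beta>). x \<in> X \<and> c \<bullet> x \<le> t \<and> \<beta> \<le> 0) (x', \<beta>') \<and> chance_feasible P S \<theta> b \<epsilon> x'}"
  then obtain x where "x \<in> X" "c \<bullet> x \<le> t" "chance_feasible P S \<theta> b \<epsilon> x"
    by (auto simp: is_arg_min_def)
  then show "drccp_value P S \<theta> b \<epsilon> X c \<le> ereal t"
    unfolding drccp_value_def by (intro INF_lower2[of x]) auto
qed

theorem corollary5:
  fixes P :: "(real ^ 'n) measure"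
    and \<mu> c :: "real ^ 'n"
    and S :: "real ^ 'n ^ 'n"
    and g :: "real \<Rightarrow> real"
    and X :: "(real ^ 'n) set"
    and b1 \<theta> \<epsilon> :: real
  assumes "0 < \<epsilon>" "\<epsilon> < 1" "0 \<le> \<theta>"
    and "elliptical \<mu> S g P"
    and "sub_gaussian P"
    and "\<forall>x\<in>X. \<forall>i. x $ i \<in> {0, 1}"
    and "\<forall>i. 0 \<le> \<mu> $ i"
    and "S = diag_mat \<mu>"
    and "0 \<le> quantile (std_elliptical g) (1 - \<epsilon>) + \<theta>"
  shows "alsox_sharp_value P S \<theta> b1 \<epsilon> X c = drccp_value P S \<theta> b1 \<epsilon> X c"
proof (rule antisym)
  note ell = assms(4) and sg = assms(5)
  let ?q = "quantile (std_elliptical g) (1 - \<epsilon>)" and ?r = "mahalanobis_dual_norm S"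
  let ?F = "alsox_sharp_objective P S \<theta> b1 \<epsilon>"
  have norm: "?r x = sqrt (\<mu> \<bullet> x)" if "x \<in> X" for x
    using that assms(6,8) by (simp add: mahalanobis_dual_norm_def diag_mat_quadratic_form_binary)
  show "alsox_sharp_value P S \<theta> b1 \<epsilon> X c \<le> drccp_value P S \<theta> b1 \<epsilon> X c"
    unfolding drccp_value_def alsox_sharp_value_def
  proof (rule INF_greatest, rule INF_lower, clarify)
    fix y assume y: "y \<in> X" "chance_feasible P S \<theta> b1 \<epsilon> y"
    let ?A = "{x \<in> X. c \<bullet> x \<le> c \<bullet> y}"
    \<comment> \<open>A least location is at once a least dual norm, so one point serves both comparisons.\<close>
    have "finite ?A"
      using assms(6) by (intro finite_subset[OF _ finite_binary_vectors]) blast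
    moreover have "?A \<noteq> {}" using y(1) by blast
    ultimately obtain x where argmin: "is_arg_min (\<lambda>x. \<mu> \<bullet> x) (\<lambda>x. x \<in> ?A) x"
      using ex_is_arg_min_if_finite by blast
    then have x: "x \<in> X" "c \<bullet> x \<le> c \<bullet> y"
      by (simp_all add: is_arg_min_linorder)
    have least: "\<mu> \<bullet> x \<le> \<mu> \<bullet> u" if "u \<in> X" "c \<bullet> u \<le> c \<bullet> y" for u
      using argmin that by (simp add: is_arg_min_linorder)
    have least': "?r x \<le> ?r u" if "u \<in> X" "c \<bullet> u \<le> c \<bullet> y" for u
      using least[OF that] norm[OF x(1)] norm[OF that(1)] by simp
    obtain \<beta> where \<beta>: "\<beta> \<le> 0" "\<And>\<beta>'. \<beta>' \<le> 0 \<Longrightarrow> ?F (x, \<beta>) \<le> ?F (x, \<beta>')"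
      using alsox_sharp_threshold_attained[OF ell sg assms(2)] by blast
    have "?F (x, \<beta>) \<le> ?F (u, \<beta>')" if "u \<in> X" "c \<bullet> u \<le> c \<bullet> y" "\<beta>' \<le> 0" for u \<beta>'
      using \<beta>(2)[OF that(3)]
        alsox_sharp_objective_mono[OF ell sg assms(3) least[OF that(1,2)] least'[OF that(1,2)]]
      by (rule order_trans)
    with x \<beta>(1) have "is_arg_min ?F (\<lambda>(u, \<beta>). u \<in> X \<and> c \<bullet> u \<le> c \<bullet> y \<and> \<beta> \<le> 0) (x, \<beta>)"
      by (auto simp: is_arg_min_linorder)
    moreover have "chance_feasible P S \<theta> b1 \<epsilon> x"
    proof -
      have "\<mu> \<bullet> y + ?r y * (\<theta> + ?q) \<le> b1"
        using y(2) unfolding elliptical_chance_feasible_iff[OF ell assms(1,2)] .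
      moreover have "?r x * (\<theta> + ?q) \<le> ?r y * (\<theta> + ?q)"
        using assms(9) least' y(1) by (intro mult_right_mono) auto
      ultimately show ?thesis
        unfolding elliptical_chance_feasible_iff[OF ell assms(1,2)] using least[OF y(1)] by simp
    qed
    ultimately show "\<exists>x' \<beta>'. is_arg_min ?F
        (\<lambda>(x, \<beta>). x \<in> X \<and> c \<bullet> x \<le> c \<bullet> y \<and> \<beta> \<le> 0) (x', \<beta>') \<and> chance_feasible P S \<theta> b1 \<epsilon> x'"
      by blast
  qed
qed (rule drccp_value_le_alsox_sharp_value)

end
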